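(* If $G$ is a graph with $\Delta(G)\le5$, then $\mu_{\mathrm{int}}(G)\le2$.
   Context: Graphs are finite and simple; $\Delta(G)$ is the maximum degree. A $k$-improper edge coloring of $G$ is a map $\alpha:E(G)\to\mathbb{N}$ such that at most $k$ edges with a common endpoint receive the same color; it is an improper interval coloring if at every vertex the colors on incident edges form a set of consecutive integers. $\mu_{\mathrm{int}}(G)$ is the smallest $k$ such that $G$ has a $k$-improper interval edge coloring. *)

theory Defs
  imports Main
begin

(* Finite simple graphs as a vertex set with a set of two-element subsets, so that an edge
   coloring is literally a function on undirected edges. *)

definition simple_graph :: "'a set \<Rightarrow> 'a set set \<Rightarrow> bool" where
  "simple_graph V E \<longleftrightarrow> finite V \<and> (\<forall>e\<in>E. e \<subseteq> V \<and> card e = 2)"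

definition incident_edges :: "'a set set \<Rightarrow> 'a \<Rightarrow> 'a set set" where
  "incident_edges E v = {e \<in> E. v \<in> e}"

definition degree :: "'a set set \<Rightarrow> 'a \<Rightarrow> nat" where
  "degree E v = card (incident_edges E v)"

(* On nat, Sup of the empty set is 0, so the graph without vertices has maximum degree 0. *)
definition max_degree :: "'a set \<Rightarrow> 'a set set \<Rightarrow> nat" where
  "max_degree V E = (SUP v\<in>V. degree E v)"

(* Only the values of the coloring on E matter in the following definitions. *)
definition improper_coloring :: "nat \<Rightarrow> 'a set \<Rightarrow> 'a set set \<Rightarrow> ('a set \<Rightarrow> nat) \<Rightarrow> bool" where
  "improper_coloring k V E \<alpha> \<longleftrightarrow>
     (\<forall>v\<in>V. \<forall>c. card {e \<in> incident_edges E v. \<alpha> e = c} \<le> k)"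

(* The case b < a gives the empty interval, which is what isolated vertices need. *)
definition interval_coloring :: "'a set \<Rightarrow> 'a set set \<Rightarrow> ('a set \<Rightarrow> nat) \<Rightarrow> bool" where
  "interval_coloring V E \<alpha> \<longleftrightarrow> (\<forall>v\<in>V. \<exists>a b. \<alpha> ` incident_edges E v = {a..b})"

definition improper_interval_coloring ::
    "nat \<Rightarrow> 'a set \<Rightarrow> 'a set set \<Rightarrow> ('a set \<Rightarrow> nat) \<Rightarrow> bool" where
  "improper_interval_coloring k V E \<alpha> \<longleftrightarrow>
     improper_coloring k V E \<alpha> \<and> interval_coloring V E \<alpha>"

definition mu_int :: "'a set \<Rightarrow> 'a set set \<Rightarrow> nat" where
  "mu_int V E = (LEAST k. \<exists>\<alpha>. improper_interval_coloring k V E \<alpha>)"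

lemma finite_edges: "simple_graph V E \<Longrightarrow> finite E"
  unfolding simple_graph_def by (meson PowI finite_Pow_iff finite_subset subsetI)

lemma degree_le_max_degree:
  assumes "simple_graph V E" "v \<in> V"
  shows "degree E v \<le> max_degree V E"
  using assms unfolding max_degree_def simple_graph_def
  by (intro cSUP_upper bdd_above_finite) auto

(* A constant coloring shows that the minimum in mu_int is over a nonempty set. *)
lemma improper_interval_coloring_exists:
  assumes "simple_graph V E"
  shows "\<exists>\<alpha>. improper_interval_coloring (max_degree V E) V E \<alpha>"
proof -
  have fin: "finite (incident_edges E v)" for v
    using finite_edges[OF assms] by (simp add: incident_edges_def)
  have "card {e \<in> incident_edges E v. 0 = c} \<le> max_degree V E" if "v \<in> V" for v and c :: nat
  proof -
    have "card {e \<in> incident_edges E v. 0 = c} \<le> degree E v"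
      unfolding degree_def by (intro card_mono fin) auto
    also have "\<dots> \<le> max_degree V E"
      by (rule degree_le_max_degree[OF assms that])
    finally show ?thesis .
  qed
  moreover have "\<exists>a b. (\<lambda>_. 0 :: nat) ` incident_edges E v = {a..b}" for v
  proof (cases "incident_edges E v = {}")
    case True
    then have "(\<lambda>_. 0 :: nat) ` incident_edges E v = {1..0}" by simp
    then show ?thesis by blast
  next
    case False
    then have "(\<lambda>_. 0 :: nat) ` incident_edges E v = {0..0}" by auto
    then show ?thesis by blast
  qed
  ultimately have "improper_interval_coloring (max_degree V E) V E (\<lambda>_. 0)"
    unfolding improper_interval_coloring_def improper_coloring_def interval_coloring_def
    by blast
  then show ?thesis by blast
qed

lemma mu_int_attained:
  assumes "simple_graph V E"
  shows "\<exists>\<alpha>. improper_interval_coloring (mu_int V E) V E \<alpha>"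
  unfolding mu_int_def by (rule LeastI_ex) (use improper_interval_coloring_exists[OF assms] in blast)

end

theory Submission
  imports Defs
begin

text \<open>
  A union of two matchings is 2-colorable, so the fibres of two maps on a finite set can be halved
  simultaneously, up to rounding. Three facts follow.
  \<^item> Every vertex of degree at least 3 chooses a neighbour so that no vertex is chosen more than twice.
  Dropping some of these choices leaves a subgraph \<open>H\<close> of maximum degree at most 2 that still
  covers all vertices of degree at least 3.
  \<^item> The rest \<open>E - H\<close> has maximum degree at most 4. Halving its darts (vertex-edge incidences)
  gives a balanced orientation.
  \<^item> Halving the darts again, with outgoing and incoming darts of a vertex separated except at
  vertices of degree 2, splits \<open>E - H\<close> into two parts of maximum degree at most 2 such that the two
  edges at a vertex of degree 2 lie in the same part.

  Color the two parts 0 and 2, and \<open>H\<close> with 1. A vertex without the color 1 has degree at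
  most 2 and hence sees at most one of the colors 0 and 2.
\<close>

section \<open>Two-coloring a union of two matchings\<close>

definition matching :: "('a \<Rightarrow> 'a \<Rightarrow> bool) \<Rightarrow> bool" where
  "matching P \<longleftrightarrow> (\<forall>x y. P x y \<longrightarrow> P y x \<and> x \<noteq> y) \<and> (\<forall>x y z. P x y \<longrightarrow> P x z \<longrightarrow> y = z)"

text \<open>Edges of \<open>P\<close> and \<open>Q\<close> alternate along every component, so there
  are no odd cycles. Induction on \<open>card X\<close> avoids describing the components: a point
  without a \<open>P\<close>-partner in \<open>X\<close> is deleted, and otherwise a
  \<open>P\<close>-edge is contracted.\<close>

lemma matchings_two_colorable:
  assumes "finite X" "matching P" "matching Q"
  shows "\<exists>c :: 'a \<Rightarrow> bool. \<forall>x\<in>X. \<forall>y\<in>X. P x y \<or> Q x y \<longrightarrow> c x \<noteq> c y"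
  using assms
proof (induction "card X" arbitrary: X P Q rule: less_induct)
  case less
  have Psym: "P x y \<Longrightarrow> P y x" and Pirr: "\<not> P x x" and Puniq: "P x y \<Longrightarrow> P x z \<Longrightarrow> y = z" for x y z
    using less.prems(2) unfolding matching_def by blast+
  have Qsym: "Q x y \<Longrightarrow> Q y x" and Qirr: "\<not> Q x x" and Quniq: "Q x y \<Longrightarrow> Q x z \<Longrightarrow> y = z" for x y z
    using less.prems(3) unfolding matching_def by blast+
  show ?case
  proof (cases "X = {}")
    case False
    then obtain x where x: "x \<in> X" by blast
    show ?thesis
    proof (cases "\<exists>y\<in>X. P x y")
      case False
      have "card (X - {x}) < card X"
        using x less.prems(1) by (meson card_Diff1_less)
      from less.hyps[OF this _ less.prems(2,3)] less.prems(1)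
      obtain c :: "'a \<Rightarrow> bool" where c: "\<forall>u\<in>X - {x}. \<forall>v\<in>X - {x}. P u v \<or> Q u v \<longrightarrow> c u \<noteq> c v" by auto
      \<comment> \<open>Within \<open>X\<close> only a single \<open>Q\<close>-neighbour can
        constrain \<open>x\<close>, and \<open>x\<close> takes the opposite of its color; without
        such a neighbour the value defaults to \<open>False\<close>.\<close>
      define c' where "c' = c (x := (\<exists>u\<in>X - {x}. Q x u \<and> \<not> c u))"
      have "c' u \<noteq> c' v" if "u \<in> X" "v \<in> X" "P u v \<or> Q u v" for u v
        using that c False Psym Qsym Qirr Quniq Pirr unfolding c'_def fun_upd_def
        by (smt (verit, ccfv_threshold) Diff_iff singletonD)
      then show ?thesis by blast
    next
      case True
      then obtain y where y: "y \<in> X" "P x y" by blast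
      then have xy: "x \<noteq> y" using Pirr by blast
      \<comment> \<open>Contract \<open>{x, y}\<close>: its two \<open>Q\<close>-neighbours become \<open>Q\<close>-adjacent. Giving \<open>x\<close> and \<open>y\<close>
        the colors opposite to those of their \<open>Q\<close>-neighbours then makes them differ.\<close>
      define X' where "X' = X - {x, y}"
      define Q' where "Q' u v \<longleftrightarrow> u \<in> X' \<and> v \<in> X' \<and> (Q u v \<or> Q x u \<and> Q y v \<or> Q y u \<and> Q x v)" for u v
      have lt: "card X' < card X"
        unfolding X'_def by (rule psubset_card_mono) (use x less.prems(1) in auto)
      have "matching Q'"
        unfolding matching_def
      proof (intro conjI allI impI)
        fix u v assume "Q' u v"
        then show "Q' v u" unfolding Q'_def using Qsym by blast
        show "u \<noteq> v" using \<open>Q' u v\<close> Qirr Qsym Quniq xy unfolding Q'_def by blast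
      next
        fix u v w assume "Q' u v" "Q' u w"
        then show "v = w" using Qsym Quniq xy unfolding Q'_def X'_def
          by (metis Diff_iff insertCI)
      qed
      from less.hyps[OF lt _ less.prems(2) this] less.prems(1)
      obtain c :: "'a \<Rightarrow> bool" where c: "\<And>u v. u \<in> X' \<Longrightarrow> v \<in> X' \<Longrightarrow> P u v \<or> Q' u v \<Longrightarrow> c u \<noteq> c v"
        unfolding X'_def by auto
      define cx where "cx \<longleftrightarrow> (\<exists>a\<in>X'. Q x a \<and> \<not> c a) \<or> (\<exists>b\<in>X'. Q y b \<and> c b)"
      have ca: "cx \<noteq> c a" if "a \<in> X'" "Q x a" for a
        using that c[of a] Quniq unfolding cx_def Q'_def by blast
      have cb: "cx = c b" if "b \<in> X'" "Q y b" for b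
        using that c[of _ b] Quniq unfolding cx_def Q'_def by blast
      define c' where "c' = c (x := cx, y := \<not> cx)"
      have "c' u \<noteq> c' v" if uv: "u \<in> X" "v \<in> X" "P u v \<or> Q u v" for u v
      proof -
        consider "u \<in> X'" "v \<in> X'" | "u = x" "v \<in> X'" | "u = y" "v \<in> X'"
          | "v = x" "u \<in> X'" | "v = y" "u \<in> X'" | "u \<in> {x, y}" "v \<in> {x, y}"
          using uv unfolding X'_def by blast
        then show ?thesis
        proof cases
          case 1
          then have "c u \<noteq> c v" using c uv(3) unfolding Q'_def by blast
          then show ?thesis using 1 by (auto simp: c'_def X'_def)
        next
          case 2
          then have "\<not> P u v" using y(2) Puniq unfolding X'_def by blast
          then show ?thesis using 2 uv ca[of v] by (auto simp: c'_def X'_def xy)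
        next
          case 3
          then have "\<not> P u v" using y(2) Psym Puniq unfolding X'_def by blast
          then show ?thesis using 3 uv cb[of v] by (auto simp: c'_def X'_def xy)
        next
          case 4
          then have "\<not> P v u" using y(2) Puniq unfolding X'_def by blast
          then have "Q v u" using uv(3) Psym Qsym by blast
          then show ?thesis using 4 ca[of u] by (auto simp: c'_def X'_def xy)
        next
          case 5
          then have "\<not> P v u" using y(2) Psym Puniq unfolding X'_def by blast
          then have "Q v u" using uv(3) Psym Qsym by blast
          then show ?thesis using 5 cb[of u] by (auto simp: c'_def X'_def xy)
        next
          case 6
          then show ?thesis using uv(3) Pirr Qirr xy by (auto simp: c'_def)
        qed
      qed
      then show ?thesis by blast
    qed
  qed simp
qed

section \<open>Halving the fibres of two maps simultaneously\<close>

text \<open>Pairing within fibres leaves at most one element of each fibre single. In the induction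
  a new element is paired with the single element of its fibre, or becomes that single element
  itself.\<close>

lemma fibre_matching_exists:
  assumes "finite X"
  shows "\<exists>P. matching P \<and> (\<forall>x y. P x y \<longrightarrow> x \<in> X \<and> y \<in> X \<and> f x = f y) \<and>
    (\<forall>x\<in>X. \<forall>y\<in>X. f x = f y \<longrightarrow> (\<nexists>z. P x z) \<longrightarrow> (\<nexists>z. P y z) \<longrightarrow> x = y)"
  using assms
proof (induction X)
  case empty
  show ?case by (rule exI[of _ "\<lambda>_ _. False"]) (simp add: matching_def)
next
  case (insert x X)
  then obtain P where P: "matching P" "\<And>x y. P x y \<Longrightarrow> x \<in> X \<and> y \<in> X \<and> f x = f y"
    "\<And>x y. x \<in> X \<Longrightarrow> y \<in> X \<Longrightarrow> f x = f y \<Longrightarrow> \<nexists>z. P x z \<Longrightarrow> \<nexists>z. P y z \<Longrightarrow> x = y"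
    by blast
  show ?case
  proof (cases "\<exists>y\<in>X. f y = f x \<and> (\<nexists>z. P y z)")
    case False
    then show ?thesis using P insert.hyps
      by (intro exI[of _ P]) (smt (verit) insert_iff)
  next
    case True
    then obtain y where y: "y \<in> X" "f y = f x" "\<nexists>z. P y z" by blast
    define R where "R u v \<longleftrightarrow> P u v \<or> u = x \<and> v = y \<or> u = y \<and> v = x" for u v
    have "matching R"
      using P(1,2) y insert.hyps unfolding matching_def R_def by (smt (verit, best))
    moreover have "\<forall>u v. R u v \<longrightarrow> u \<in> insert x X \<and> v \<in> insert x X \<and> f u = f v"
      using P(2) y unfolding R_def by auto
    moreover have "u = v" if "u \<in> insert x X" "v \<in> insert x X" "f u = f v" "\<nexists>z. R u z" "\<nexists>z. R v z" for u v
      using that P(3)[of u v] unfolding R_def by blast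
    ultimately show ?thesis by blast
  qed
qed

text \<open>Fibres of even size are split exactly; for odd size either rounding is allowed.\<close>

definition halves :: "('a \<Rightarrow> 'b) \<Rightarrow> 'a set \<Rightarrow> 'a set \<Rightarrow> bool" where
  "halves f X Y \<longleftrightarrow> (\<forall>a. card {x \<in> X. f x = a} div 2 \<le> card {x \<in> Y. f x = a} \<and>
     card {x \<in> Y. f x = a} \<le> (card {x \<in> X. f x = a} + 1) div 2)"

text \<open>Partners have opposite colors, so the partner map injects the matched elements of color
  \<open>c\<close> into the others; at most one element of the fibre is unmatched. Applying this to
  \<open>c\<close> and to its negation bounds the imbalance on both sides.\<close>

lemma card_fibre_unbalance:
  assumes "finite X" "matching P"
    and fibre: "\<And>x y. P x y \<Longrightarrow> x \<in> X \<and> y \<in> X \<and> f x = f y"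
    and maximal: "\<And>x y. x \<in> X \<Longrightarrow> y \<in> X \<Longrightarrow> f x = f y \<Longrightarrow> \<nexists>z. P x z \<Longrightarrow> \<nexists>z. P y z \<Longrightarrow> x = y"
    and c: "\<And>x y. P x y \<Longrightarrow> c x \<noteq> c y"
  shows "card {x \<in> X. f x = a \<and> c x} \<le> card {x \<in> X. f x = a \<and> \<not> c x} + 1"
proof -
  let ?U = "{x \<in> X. f x = a \<and> (\<nexists>z. P x z)}"
  let ?M = "{x \<in> X. f x = a \<and> c x \<and> (\<exists>z. P x z)}"
  have "card ?U \<le> 1"
    using maximal by (subst card_le_Suc0_iff_eq[folded One_nat_def]) (use assms(1) in auto)
  moreover have "card ?M \<le> card {x \<in> X. f x = a \<and> \<not> c x}"
  proof (rule card_inj_on_le)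
    let ?p = "\<lambda>x. SOME z. P x z"
    have p: "P x (?p x)" if "x \<in> ?M" for x using that someI_ex[of "P x"] by blast
    show "inj_on ?p ?M"
      using p assms(2) unfolding matching_def by (intro inj_onI) metis
    show "?p ` ?M \<subseteq> {x \<in> X. f x = a \<and> \<not> c x}"
    proof
      fix z assume "z \<in> ?p ` ?M"
      then obtain x where x: "x \<in> ?M" "z = ?p x" by blast
      then have "P x z" using p by simp
      then show "z \<in> {x \<in> X. f x = a \<and> \<not> c x}" using x(1) fibre[of x z] c[of x z] by auto
    qed
  qed (use assms(1) in auto)
  moreover have "card {x \<in> X. f x = a \<and> c x} \<le> card (?M \<union> ?U)"
    by (rule card_mono) (use assms(1) in auto)
  moreover have "card (?M \<union> ?U) \<le> card ?M + card ?U" by (rule card_Un_le)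
  ultimately show ?thesis by linarith
qed

lemma halves_of_matching:
  assumes "finite X" "matching P"
    and "\<And>x y. P x y \<Longrightarrow> x \<in> X \<and> y \<in> X \<and> f x = f y"
    and "\<And>x y. x \<in> X \<Longrightarrow> y \<in> X \<Longrightarrow> f x = f y \<Longrightarrow> \<nexists>z. P x z \<Longrightarrow> \<nexists>z. P y z \<Longrightarrow> x = y"
    and "\<And>x y. P x y \<Longrightarrow> c x \<noteq> c y"
  shows "halves f X {x \<in> X. c x}"
  unfolding halves_def
proof
  fix a
  have "card {x \<in> X. f x = a \<and> c x} \<le> card {x \<in> X. f x = a \<and> \<not> c x} + 1"
    by (rule card_fibre_unbalance[OF assms])
  moreover have "card {x \<in> X. f x = a \<and> \<not> c x} \<le> card {x \<in> X. f x = a \<and> \<not> \<not> c x} + 1"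
    by (rule card_fibre_unbalance[OF assms(1-4)]) (use assms(5) in auto)
  moreover have "card {x \<in> X. f x = a} = card {x \<in> X. f x = a \<and> c x} + card {x \<in> X. f x = a \<and> \<not> c x}"
    by (subst card_Un_disjoint[symmetric]) (use assms(1) in \<open>auto intro: arg_cong[where f = card]\<close>)
  moreover have "{x \<in> {x \<in> X. c x}. f x = a} = {x \<in> X. f x = a \<and> c x}" by auto
  ultimately show "card {x \<in> X. f x = a} div 2 \<le> card {x \<in> {x \<in> X. c x}. f x = a} \<and>
     card {x \<in> {x \<in> X. c x}. f x = a} \<le> (card {x \<in> X. f x = a} + 1) div 2"
    by (simp only: not_not) linarith
qed

text \<open>With each \<open>x\<close> read as an edge joining \<open>f x\<close> to
  \<open>g x\<close>, this is a balanced 2-coloring of the edges of a bipartite multigraph. A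
  coloring that separates the pairs of both fibre matchings halves both families of fibres at
  once.\<close>

lemma simultaneous_halving:
  assumes "finite X"
  obtains Y where "Y \<subseteq> X" "halves f X Y" "halves g X Y"
proof -
  from fibre_matching_exists[OF assms, of f] obtain P where P: "matching P"
    "\<And>x y. P x y \<Longrightarrow> x \<in> X \<and> y \<in> X \<and> f x = f y"
    "\<And>x y. x \<in> X \<Longrightarrow> y \<in> X \<Longrightarrow> f x = f y \<Longrightarrow> \<nexists>z. P x z \<Longrightarrow> \<nexists>z. P y z \<Longrightarrow> x = y" by blast
  from fibre_matching_exists[OF assms, of g] obtain Q where Q: "matching Q"
    "\<And>x y. Q x y \<Longrightarrow> x \<in> X \<and> y \<in> X \<and> g x = g y"
    "\<And>x y. x \<in> X \<Longrightarrow> y \<in> X \<Longrightarrow> g x = g y \<Longrightarrow> \<nexists>z. Q x z \<Longrightarrow> \<nexists>z. Q y z \<Longrightarrow> x = y" by blast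
  obtain c :: "'a \<Rightarrow> bool" where c: "\<forall>x\<in>X. \<forall>y\<in>X. P x y \<or> Q x y \<longrightarrow> c x \<noteq> c y"
    using matchings_two_colorable[OF assms P(1) Q(1)] by blast
  have "halves f X {x \<in> X. c x}"
    by (rule halves_of_matching[OF assms P]) (use c P(2) in blast)+
  moreover have "halves g X {x \<in> X. c x}"
    by (rule halves_of_matching[OF assms Q]) (use c Q(2) in blast)+
  ultimately show thesis using that[of "{x \<in> X. c x}"] by blast
qed

section \<open>Selecting edges of a functional graph\<close>

text \<open>
  The edges \<open>{u, \<phi> u}\<close> for \<open>u \<in> X\<close> cover \<open>T\<close>. Since a vertex of \<open>X\<close> has at most one preimage in
  \<open>X\<close>, its own edge does not push its degree above 2.
\<close>

lemma functional_graph_cover: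
  assumes "finite T"
  shows "\<exists>X\<subseteq>T. (\<forall>v\<in>T. v \<in> X \<or> (\<exists>u\<in>X. \<phi> u = v)) \<and> (\<forall>v\<in>X. card {u \<in> X. \<phi> u = v} \<le> 1)"
  using assms
proof (induction "card T" arbitrary: T rule: less_induct)
  case less
  show ?case
  proof (cases "T \<subseteq> \<phi> ` T")
    case True
    \<comment> \<open>\<open>\<phi>\<close> maps \<open>T\<close> onto a superset of
      \<open>T\<close>, so by counting it permutes \<open>T\<close>, and all of \<open>T\<close> can
      be selected.\<close>
    then have "card T \<le> card (\<phi> ` T)" using less.prems by (intro card_mono) auto
    then have "inj_on \<phi> T" using less.prems by (simp add: card_image_le eq_card_imp_inj_on le_antisym)
    then have "card {u \<in> T. \<phi> u = v} \<le> 1" for v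
      using less.prems by (subst card_le_Suc0_iff_eq[folded One_nat_def]) (auto dest: inj_onD)
    then show ?thesis by (intro exI[of _ T]) auto
  next
    case False
    \<comment> \<open>Selecting \<open>v\<close>, which has no preimage in \<open>T\<close>, covers
      both \<open>v\<close> and \<open>\<phi> v\<close>. Removing both keeps \<open>\<phi> v\<close>
      out of the recursive selection, so the additional preimage \<open>v\<close> spoils no bound
      there.\<close>
    then obtain v where v: "v \<in> T" "v \<notin> \<phi> ` T" by blast
    define T' where "T' = T - {v, \<phi> v}"
    have "card T' < card T"
      unfolding T'_def by (rule psubset_card_mono) (use v less.prems in auto)
    from less.hyps[OF this] less.prems obtain X where X: "X \<subseteq> T'"
      "\<forall>v\<in>T'. v \<in> X \<or> (\<exists>u\<in>X. \<phi> u = v)" "\<forall>v\<in>X. card {u \<in> X. \<phi> u = v} \<le> 1"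
      unfolding T'_def by auto
    have "card {u \<in> insert v X. \<phi> u = w} \<le> 1" if w: "w \<in> insert v X" for w
    proof (cases "w = v")
      case True
      then have "{u \<in> insert v X. \<phi> u = w} = {}" using v X(1) unfolding T'_def by force
      then show ?thesis by (metis card.empty zero_le_one)
    next
      case False
      then have "{u \<in> insert v X. \<phi> u = w} = {u \<in> X. \<phi> u = w}"
        using w X(1) unfolding T'_def by blast
      then show ?thesis using X(3) w False by simp
    qed
    moreover have "insert v X \<subseteq> T" using v X(1) unfolding T'_def by blast
    moreover have "\<forall>w\<in>T. w \<in> insert v X \<or> (\<exists>u\<in>insert v X. \<phi> u = w)"
      using X(2) unfolding T'_def by blast
    ultimately show ?thesis by blast
  qed
qed


section \<open>Splitting a graph of maximum degree 4\<close>

lemma halves_pair_fibre: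
  assumes "halves f X Y" "{x \<in> X. f x = a} = {u, w}" "u \<noteq> w" "Y \<subseteq> X"
  shows "u \<in> Y \<longleftrightarrow> w \<notin> Y"
proof -
  have "card {x \<in> X. f x = a} = 2" using assms(2,3) by simp
  then have one: "card {x \<in> Y. f x = a} = 1"
    using assms(1)[unfolded halves_def, rule_format, of a] by simp
  have "{x \<in> Y. f x = a} = Y \<inter> {u, w}" using assms(2,4) by blast
  then show ?thesis using one assms(3) by (cases "u \<in> Y"; cases "w \<in> Y") auto
qed

text \<open>At a vertex of degree 3 or 4 at most two darts go out and at most two come in.
  \<open>Y\<close> separates both pairs, so each color receives at most one outgoing and one
  incoming edge. At a vertex of degree 2 one dart goes out and one comes in; \<open>r\<close> puts
  them into the same fibre, so \<open>Y\<close> separates them too, which now makes their colors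
  equal.\<close>

lemma degree_four_split:
  assumes fin: "finite F" and two: "\<And>e. e \<in> F \<Longrightarrow> card e = 2"
    and deg: "\<And>v. degree F v \<le> 4"
  obtains k :: "'a set \<Rightarrow> bool" where
    "\<And>v b. card {e \<in> incident_edges F v. k e = b} \<le> 2"
    "\<And>v e e'. degree F v = 2 \<Longrightarrow> e \<in> incident_edges F v \<Longrightarrow> e' \<in> incident_edges F v \<Longrightarrow> k e = k e'"
proof -
  define D where "D = {(v, e). e \<in> F \<and> v \<in> e}"
  have fine: "finite e" if "e \<in> F" for e using two[OF that] by (metis card.infinite zero_neq_numeral)
  have fin_inc: "finite (incident_edges F v)" for v using fin by (simp add: incident_edges_def)
  have "D \<subseteq> \<Union>F \<times> F" unfolding D_def by auto
  then have finD: "finite D" using fin fine by (meson finite_SigmaI finite_Union finite_subset)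
  obtain Out where Out: "Out \<subseteq> D" "halves snd D Out" "halves fst D Out"
    using simultaneous_halving[OF finD] .
  define r where "r = (\<lambda>(v, e). (v, degree F v = 2 \<or> (v, e) \<in> Out))"
  obtain Y where Y: "Y \<subseteq> D" "halves snd D Y" "halves r D Y"
    using simultaneous_halving[OF finD] .
  \<comment> \<open>The color of an edge is read off at its tail. At the head it is the opposite membership in \<open>Y\<close>,
    so two outgoing or two incoming darts separated by \<open>Y\<close> get different colors, but an incoming
    and an outgoing one get the same color.\<close>
  define k where "k e \<longleftrightarrow> (\<exists>v. (v, e) \<in> Out \<and> (v, e) \<in> Y)" for e
  have k: "k e \<longleftrightarrow> ((v, e) \<in> Out \<longleftrightarrow> (v, e) \<in> Y)" if "e \<in> incident_edges F v" for v e
  proof -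
    have e: "e \<in> F" "v \<in> e" using that by (auto simp: incident_edges_def)
    obtain w where w: "e = {v, w}" "w \<noteq> v"
      using two[OF e(1)] e(2) by (metis card_2_iff insertE insert_commute singletonD)
    have fib: "{x \<in> D. snd x = e} = {(v, e), (w, e)}"
    proof (rule set_eqI)
      fix x :: "'a \<times> 'a set"
      obtain u g where x: "x = (u, g)" by fastforce
      have "u \<in> e \<longleftrightarrow> u = v \<or> u = w" by (simp add: w(1))
      then show "x \<in> {x \<in> D. snd x = e} \<longleftrightarrow> x \<in> {(v, e), (w, e)}"
        using e(1) unfolding x D_def by (cases "g = e") simp_all
    qed
    have "(v, e) \<in> Out \<longleftrightarrow> (w, e) \<notin> Out"
      by (rule halves_pair_fibre[OF Out(2) fib _ Out(1)]) (use w(2) in simp)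
    moreover have "(v, e) \<in> Y \<longleftrightarrow> (w, e) \<notin> Y"
      by (rule halves_pair_fibre[OF Y(2) fib _ Y(1)]) (use w(2) in simp)
    moreover have "k e \<longleftrightarrow> (v, e) \<in> Out \<and> (v, e) \<in> Y \<or> (w, e) \<in> Out \<and> (w, e) \<in> Y"
      using Out(1) w(1) unfolding k_def D_def by blast
    ultimately show ?thesis by blast
  qed
  have at: "{x \<in> D. fst x = v} = Pair v ` incident_edges F v" for v
    unfolding D_def incident_edges_def by auto
  show thesis
  proof (rule that[of k])
    fix v b
    let ?I = "incident_edges F v"
    show "card {e \<in> ?I. k e = b} \<le> 2"
    proof (cases "degree F v \<le> 2")
      case True
      have "card {e \<in> ?I. k e = b} \<le> card ?I" by (rule card_mono[OF fin_inc]) auto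
      then show ?thesis using True unfolding degree_def by linarith
    next
      case False
      let ?o = "{e \<in> ?I. (v, e) \<in> Out}" and ?i = "{e \<in> ?I. (v, e) \<notin> Out}"
      let ?oY = "{e \<in> ?o. (v, e) \<in> Y}" and ?iY = "{e \<in> ?i. (v, e) \<in> Y}"
      let ?on = "{e \<in> ?o. (v, e) \<notin> Y}" and ?in = "{e \<in> ?i. (v, e) \<notin> Y}"
      have split: "card A = card {x \<in> A. p x} + card {x \<in> A. \<not> p x}"
        if "finite A" for A :: "'a set set" and p
        by (subst card_Un_disjoint[symmetric]) (use that in \<open>auto intro: arg_cong[where f = card]\<close>)
      have "{x \<in> Out. fst x = v} = Pair v ` ?o"
        using Out(1) unfolding D_def incident_edges_def by (auto simp: image_iff)
      then have "card {x \<in> Out. fst x = v} = card ?o" by (simp add: card_image inj_on_def)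
      moreover have "card {x \<in> D. fst x = v} = degree F v"
        unfolding at degree_def by (simp add: card_image inj_on_def)
      ultimately have o: "degree F v div 2 \<le> card ?o" "card ?o \<le> (degree F v + 1) div 2"
        using Out(3)[unfolded halves_def, rule_format, of v] by simp_all
      have oi: "degree F v = card ?o + card ?i"
        unfolding degree_def by (rule split[OF fin_inc])
      have o2: "card ?o \<le> 2" and i2: "card ?i \<le> 2" using o oi deg[of v] by linarith+
      have "{x \<in> D. r x = (v, True)} = Pair v ` ?o" "{x \<in> D. r x = (v, False)} = Pair v ` ?i"
        "{x \<in> Y. r x = (v, True)} = Pair v ` ?oY" "{x \<in> Y. r x = (v, False)} = Pair v ` ?iY"
        using False Y(1) Out(1) unfolding r_def D_def incident_edges_def by auto
      then have "card {x \<in> D. r x = (v, True)} = card ?o" "card {x \<in> D. r x = (v, False)} = card ?i"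
        "card {x \<in> Y. r x = (v, True)} = card ?oY" "card {x \<in> Y. r x = (v, False)} = card ?iY"
        by (simp_all add: card_image inj_on_def)
      then have oY: "card ?o div 2 \<le> card ?oY" "card ?oY \<le> (card ?o + 1) div 2"
        and iY: "card ?i div 2 \<le> card ?iY" "card ?iY \<le> (card ?i + 1) div 2"
        using Y(3)[unfolded halves_def, rule_format, of "(v, True)"]
          Y(3)[unfolded halves_def, rule_format, of "(v, False)"] by simp_all
      have "card ?o = card ?oY + card ?on" "card ?i = card ?iY + card ?in"
        by (rule split; use fin_inc in simp)+
      then have le1: "card ?oY \<le> 1" "card ?on \<le> 1" "card ?iY \<le> 1" "card ?in \<le> 1"
        using oY iY o2 i2 by linarith+
      show ?thesis
      proof (cases b)
        case True
        \<comment> \<open>Color \<open>True\<close> means outgoing and in \<open>Y\<close>, or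
          incoming and not in \<open>Y\<close>: at most one edge of each sort.\<close>
        have eq: "{e \<in> ?I. k e = b} = ?oY \<union> ?in" using k True by auto
        show ?thesis unfolding eq using card_Un_le[of ?oY ?in] le1 by linarith
      next
        case False
        have eq: "{e \<in> ?I. k e = b} = ?on \<union> ?iY" using k False by auto
        show ?thesis unfolding eq using card_Un_le[of ?on ?iY] le1 by linarith
      qed
    qed
  next
    fix v e e'
    assume v: "degree F v = 2" and e: "e \<in> incident_edges F v" "e' \<in> incident_edges F v"
    show "k e = k e'"
    proof (cases "e = e'")
      case False
      have "{e, e'} = incident_edges F v"
        by (rule card_seteq[OF fin_inc]) (use v e False in \<open>simp_all add: degree_def\<close>)
      then have fib: "{x \<in> D. fst x = v} = {(v, e), (v, e')}" unfolding at by auto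
      moreover have "{x \<in> D. r x = (v, True)} = {x \<in> D. fst x = v}"
        using v unfolding r_def by auto
      ultimately have fib': "{x \<in> D. r x = (v, True)} = {(v, e), (v, e')}" by simp
      have "(v, e) \<in> Out \<longleftrightarrow> (v, e') \<notin> Out"
        by (rule halves_pair_fibre[OF Out(3) fib _ Out(1)]) (use False in auto)
      moreover have "(v, e) \<in> Y \<longleftrightarrow> (v, e') \<notin> Y"
        by (rule halves_pair_fibre[OF Y(3) fib' _ Y(1)]) (use False in auto)
      ultimately show ?thesis using k e by blast
    qed simp
  qed
qed

section \<open>A covering subgraph of maximum degree 2\<close>

text \<open>If every vertex of \<open>T\<close> spread one unit evenly over its at least 3
  neighbours, a vertex would receive at most 5/3. Repeated halving turns this fractional choice into
  an integral one with load at most 2.\<close>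

lemma neighbour_choice:
  assumes "finite E" and two: "\<And>e. e \<in> E \<Longrightarrow> card e = 2"
    and deg: "\<And>v. degree E v \<le> 5" and T: "\<And>v. v \<in> T \<Longrightarrow> 3 \<le> degree E v"
  obtains \<phi> where "\<And>v. v \<in> T \<Longrightarrow> {v, \<phi> v} \<in> E" "\<And>w. card {v \<in> T. \<phi> v = w} \<le> 2"
proof -
  \<comment> \<open>With three copies of each edge, halving three times gives 9, 4, 2, 1 as lower bounds on the side
    of \<open>T\<close> and 15, 8, 4, 2 as upper bounds on the side of the chosen neighbours.\<close>
  define X where "X = {(v, w, i). v \<in> T \<and> {v, w} \<in> E \<and> i < (3 :: nat)}"
  define l :: "'a \<times> 'a \<times> nat \<Rightarrow> 'a" where "l = fst"
  define r :: "'a \<times> 'a \<times> nat \<Rightarrow> 'a" where "r = fst \<circ> snd"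
  have "X \<subseteq> \<Union>E \<times> \<Union>E \<times> {..<3}" unfolding X_def by auto
  moreover have "finite (\<Union>E)"
    using assms(1) two by (metis card.infinite finite_Union zero_neq_numeral)
  ultimately have "finite X" by (meson finite_SigmaI finite_lessThan finite_subset)
  obtain X1 where X1: "X1 \<subseteq> X" "halves l X X1" "halves r X X1"
    using simultaneous_halving[OF \<open>finite X\<close>] .
  then have "finite X1" using \<open>finite X\<close> finite_subset by blast
  obtain X2 where X2: "X2 \<subseteq> X1" "halves l X1 X2" "halves r X1 X2"
    using simultaneous_halving[OF \<open>finite X1\<close>] .
  then have "finite X2" using \<open>finite X1\<close> finite_subset by blast
  obtain X3 where X3: "X3 \<subseteq> X2" "halves l X2 X3" "halves r X2 X3"
    using simultaneous_halving[OF \<open>finite X2\<close>] .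
  then have "finite X3" using \<open>finite X2\<close> finite_subset by blast
  have nbrs: "card {w. {v, w} \<in> E} = degree E v" for v
    unfolding degree_def
  proof (rule bij_betw_same_card[of "\<lambda>w. {v, w}"], rule bij_betwI')
    fix e assume "e \<in> incident_edges E v"
    then have "e \<in> E" "v \<in> e" "card e = 2" using two by (auto simp: incident_edges_def)
    then show "\<exists>w\<in>{w. {v, w} \<in> E}. e = {v, w}" by (auto simp: card_2_iff insert_commute)
  qed (auto simp: incident_edges_def doubleton_eq_iff)
  have fin_nbrs: "finite {w. {v, w} \<in> E}" for v
    by (rule finite_subset[OF _ \<open>finite (\<Union>E)\<close>]) auto
  have lower: "9 \<le> card {x \<in> X. l x = v}" if "v \<in> T" for v
  proof -
    have "{x \<in> X. l x = v} = Pair v ` ({w. {v, w} \<in> E} \<times> {..<3})"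
      using that unfolding X_def l_def by auto
    then have "card {x \<in> X. l x = v} = degree E v * 3"
      by (simp add: card_image inj_on_def card_cartesian_product nbrs)
    then show ?thesis using T[OF that] by linarith
  qed
  have upper: "card {x \<in> X. r x = w} \<le> 15" for w
  proof -
    have "{x \<in> X. r x = w} \<subseteq> (\<lambda>(v, i). (v, w, i)) ` ({v. {w, v} \<in> E} \<times> {..<3})"
      unfolding X_def r_def by (auto simp: insert_commute image_iff)
    then have "card {x \<in> X. r x = w} \<le> card ({v. {w, v} \<in> E} \<times> {..<3 :: nat})"
      using fin_nbrs by (intro surj_card_le) auto
    also have "\<dots> = degree E w * 3" by (simp add: card_cartesian_product nbrs)
    finally show ?thesis using deg[of w] by linarith
  qed
  have "{x \<in> X3. l x = v} \<noteq> {}" if "v \<in> T" for v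
  proof -
    have "card {x \<in> X. l x = v} div 2 \<le> card {x \<in> X1. l x = v}"
      "card {x \<in> X1. l x = v} div 2 \<le> card {x \<in> X2. l x = v}"
      "card {x \<in> X2. l x = v} div 2 \<le> card {x \<in> X3. l x = v}"
      using X1(2) X2(2) X3(2) unfolding halves_def by blast+
    then have "1 \<le> card {x \<in> X3. l x = v}" using lower[OF that] by linarith
    then show ?thesis by (metis card.empty not_one_le_zero)
  qed
  then have "\<forall>v\<in>T. \<exists>w i. (v, w, i) \<in> X3" unfolding l_def by fastforce
  then obtain \<phi> \<iota> where \<phi>: "\<And>v. v \<in> T \<Longrightarrow> (v, \<phi> v, \<iota> v) \<in> X3" by metis
  show thesis
  proof (rule that[of \<phi>])
    show "{v, \<phi> v} \<in> E" if "v \<in> T" for v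
      using \<phi>[OF that] X1(1) X2(1) X3(1) unfolding X_def by blast
    fix w
    have "card {x \<in> X1. r x = w} \<le> (card {x \<in> X. r x = w} + 1) div 2"
      "card {x \<in> X2. r x = w} \<le> (card {x \<in> X1. r x = w} + 1) div 2"
      "card {x \<in> X3. r x = w} \<le> (card {x \<in> X2. r x = w} + 1) div 2"
      using X1(3) X2(3) X3(3) unfolding halves_def by blast+
    then have "card {x \<in> X3. r x = w} \<le> 2" using upper[of w] by linarith
    moreover have "card {v \<in> T. \<phi> v = w} \<le> card {x \<in> X3. r x = w}"
      by (rule card_inj_on_le[of "\<lambda>v. (v, \<phi> v, \<iota> v)"])
        (use \<phi> \<open>finite X3\<close> in \<open>auto simp: inj_on_def r_def\<close>)
    ultimately show "card {v \<in> T. \<phi> v = w} \<le> 2" by linarith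
  qed
qed

text \<open>After thinning the choices to \<open>X\<close>, a vertex of \<open>X\<close> has its own
  edge and at most one edge from a vertex choosing it, while a vertex outside \<open>X\<close> only
  has edges from the at most two vertices choosing it.\<close>

lemma covering_subgraph:
  assumes "finite E" "\<And>e. e \<in> E \<Longrightarrow> card e = 2" "\<And>v. degree E v \<le> 5"
  obtains H where "H \<subseteq> E" "\<forall>v. degree H v \<le> 2" "\<forall>v. 3 \<le> degree E v \<longrightarrow> 1 \<le> degree H v"
proof -
  define T where "T = {v. 3 \<le> degree E v}"
  obtain \<phi> where \<phi>: "\<And>v. v \<in> T \<Longrightarrow> {v, \<phi> v} \<in> E" "\<And>w. card {v \<in> T. \<phi> v = w} \<le> 2"
    using neighbour_choice[of E T] assms unfolding T_def by blast
  have "finite (\<Union>E)"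
    using assms(1,2) by (metis card.infinite finite_Union zero_neq_numeral)
  moreover have "T \<subseteq> \<Union>E" using \<phi>(1) by blast
  ultimately have "finite T" using finite_subset by blast
  from functional_graph_cover[OF this, of \<phi>] obtain X where "X \<subseteq> T \<and>
    (\<forall>v\<in>T. v \<in> X \<or> (\<exists>u\<in>X. \<phi> u = v)) \<and> (\<forall>v\<in>X. card {u \<in> X. \<phi> u = v} \<le> 1)" ..
  then have X: "X \<subseteq> T" "\<And>v. v \<in> T \<Longrightarrow> v \<in> X \<or> (\<exists>u\<in>X. \<phi> u = v)"
    "\<And>v. v \<in> X \<Longrightarrow> card {u \<in> X. \<phi> u = v} \<le> 1" by simp_all
  have finX: "finite X" using X(1) \<open>finite T\<close> finite_subset by blast
  define H where "H = (\<lambda>v. {v, \<phi> v}) ` X"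
  have finH: "finite (incident_edges H v)" for v
    using finX unfolding H_def incident_edges_def by simp
  show thesis
  proof (rule that[of H])
    show "H \<subseteq> E" using X(1) \<phi>(1) unfolding H_def by blast
    show "\<forall>v. degree H v \<le> 2"
    proof
      fix v
      let ?C = "{u \<in> X. \<phi> u = v}"
      have finC: "finite ?C" using finX by simp
      show "degree H v \<le> 2"
      proof (cases "v \<in> X")
        case True
        have sub: "incident_edges H v \<subseteq> (\<lambda>u. {u, \<phi> u}) ` insert v ?C"
          unfolding H_def incident_edges_def by auto
        have "degree H v \<le> card (insert v ?C)"
          unfolding degree_def by (rule surj_card_le[OF _ sub]) (simp add: finC)
        also have "\<dots> \<le> Suc (card ?C)" by (rule card_insert_le_m1) auto
        finally show ?thesis using X(3)[OF True] by linarith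
      next
        case False
        then have sub: "incident_edges H v \<subseteq> (\<lambda>u. {u, \<phi> u}) ` ?C"
          unfolding H_def incident_edges_def by auto
        have "degree H v \<le> card ?C"
          unfolding degree_def by (rule surj_card_le[OF finC sub])
        also have "\<dots> \<le> card {u \<in> T. \<phi> u = v}"
          using X(1) \<open>finite T\<close> by (intro card_mono) auto
        finally show ?thesis using \<phi>(2)[of v] by linarith
      qed
    qed
    show "\<forall>v. 3 \<le> degree E v \<longrightarrow> 1 \<le> degree H v"
    proof (intro allI impI)
      fix v assume "3 \<le> degree E v"
      then have "v \<in> X \<or> (\<exists>u\<in>X. \<phi> u = v)" using X(2) unfolding T_def by blast
      then have "incident_edges H v \<noteq> {}" unfolding H_def incident_edges_def by blast
      then show "1 \<le> degree H v"
        using finH[of v] unfolding degree_def by (simp add: Suc_leI card_gt_0_iff)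
    qed
  qed
qed

section \<open>Coloring with 0, 1 and 2\<close>

text \<open>The only subset of \<open>{0, 1, 2}\<close> that is not an interval is
  \<open>{0, 2}\<close>.\<close>

lemma subset_three_interval:
  fixes A :: "nat set"
  assumes "A \<subseteq> {0, 1, 2}" "0 \<in> A \<Longrightarrow> 2 \<in> A \<Longrightarrow> 1 \<in> A"
  shows "\<exists>a b. A = {a..b}"
proof (cases "A = {}")
  case True
  then have "A = {1..0}" by simp
  then show ?thesis by blast
next
  case False
  have fin: "finite A" using assms(1) finite_subset by blast
  have le2: "x \<le> 2" if "x \<in> A" for x using assms(1) that by auto
  have ends: "Min A \<in> A" "Max A \<in> A" using fin False by simp_all
  have "A = {Min A..Max A}"
  proof (rule subset_antisym; rule subsetI)
    fix x assume "x \<in> A"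
    then show "x \<in> {Min A..Max A}" using fin by simp
  next
    fix x assume "x \<in> {Min A..Max A}"
    then have x: "Min A \<le> x" "x \<le> Max A" by simp_all
    consider "x = Min A" | "x = Max A" | "Min A < x" "x < Max A" using x by linarith
    then show "x \<in> A"
    proof cases
      case 3
      then have "Min A = 0" "x = 1" "Max A = 2" using le2[OF ends(2)] by linarith+
      then show ?thesis using ends assms(2) by metis
    qed (use ends in metis)+
  qed
  then show ?thesis by blast
qed

theorem theorem22:
  fixes V :: "'a set" and E :: "'a set set"
  assumes "simple_graph V E"
    and "max_degree V E \<le> 5"
  shows "mu_int V E \<le> 2"
proof -
  have fin: "finite E" using finite_edges[OF assms(1)] .
  have two: "card e = 2" "e \<subseteq> V" if "e \<in> E" for e
    using assms(1) that unfolding simple_graph_def by blast+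
  have deg: "degree E v \<le> 5" for v
  proof (cases "v \<in> V")
    case True
    then show ?thesis using degree_le_max_degree[OF assms(1)] assms(2) by (meson le_trans)
  next
    case False
    then have "incident_edges E v = {}" using two(2) unfolding incident_edges_def by blast
    then show ?thesis by (simp add: degree_def)
  qed
  obtain H where H: "H \<subseteq> E" "\<forall>v. degree H v \<le> 2" "\<forall>v. 3 \<le> degree E v \<longrightarrow> 1 \<le> degree H v"
    using covering_subgraph[OF fin two(1) deg] .
  define F where "F = E - H"
  have "finite F" using fin by (simp add: F_def)
  have fin_inc: "finite (incident_edges E' v)" if "E' \<subseteq> E" for v E'
    using fin that by (simp add: incident_edges_def finite_subset)
  have sum: "degree E v = degree H v + degree F v" for v
  proof -
    have "incident_edges E v = incident_edges H v \<union> incident_edges F v"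
      "incident_edges H v \<inter> incident_edges F v = {}"
      using H(1) unfolding incident_edges_def F_def by blast+
    then show ?thesis unfolding degree_def
      using fin_inc[OF H(1)] fin_inc[of F] by (simp add: card_Un_disjoint F_def)
  qed
  \<comment> \<open>A vertex of degree 5 loses at least one edge to \<open>H\<close>.\<close>
  have degF: "degree F v \<le> 4" for v
    using sum[of v] deg[of v] H(3)[rule_format, of v] by linarith
  obtain k :: "'a set \<Rightarrow> bool" where
    k: "\<And>v b. card {e \<in> incident_edges F v. k e = b} \<le> 2"
      "\<And>v e e'. degree F v = 2 \<Longrightarrow> e \<in> incident_edges F v \<Longrightarrow> e' \<in> incident_edges F v \<Longrightarrow> k e = k e'"
    using degree_four_split[OF \<open>finite F\<close> _ degF] two(1) unfolding F_def by blast
  define \<alpha> :: "'a set \<Rightarrow> nat" where "\<alpha> e = (if e \<in> H then 1 else if k e then 0 else 2)" for e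
  have "card {e \<in> incident_edges E v. \<alpha> e = c} \<le> 2" for v c
  proof -
    have *: "{e \<in> incident_edges E v. \<alpha> e = c} =
      (if c = 1 then incident_edges H v
       else if c = 0 then {e \<in> incident_edges F v. k e = True}
       else if c = 2 then {e \<in> incident_edges F v. k e = False} else {})"
      using H(1) unfolding \<alpha>_def F_def incident_edges_def by auto
    show ?thesis unfolding * using H(2)[rule_format, of v] k(1)[of v True] k(1)[of v False]
      by (simp add: degree_def)
  qed
  moreover have "\<exists>a b. \<alpha> ` incident_edges E v = {a..b}" for v
  proof -
    let ?A = "\<alpha> ` incident_edges E v"
    have sub: "?A \<subseteq> {0, 1, 2}" unfolding \<alpha>_def by auto
    have mid: "1 \<in> ?A" if ends: "0 \<in> ?A" "2 \<in> ?A"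
    proof (rule ccontr)
      assume no1: "1 \<notin> ?A"
      obtain e e' where e: "e \<in> incident_edges E v" "\<alpha> e = 0" "e' \<in> incident_edges E v" "\<alpha> e' = 2"
        using ends by (metis imageE)
      then have kk: "e \<in> incident_edges F v" "e' \<in> incident_edges F v" "k e" "\<not> k e'"
        unfolding \<alpha>_def F_def incident_edges_def by (auto split: if_splits)
      \<comment> \<open>Without an edge of \<open>H\<close>, the vertex has degree at most 2 in
        \<open>E\<close>. The two differently colored edges then make its degree in \<open>F\<close>
        exactly 2, where \<open>k\<close> is constant.\<close>
      have "card {e, e'} \<le> degree F v"
        unfolding degree_def by (rule card_mono[OF fin_inc]) (use kk in \<open>auto simp: F_def\<close>)
      moreover have "card {e, e'} = 2" using kk by (auto simp: card_insert_if)
      moreover have "incident_edges H v = {}"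
        using no1 H(1) unfolding \<alpha>_def incident_edges_def by force
      then have "degree H v = 0" by (simp add: degree_def)
      ultimately have "degree F v = 2" using H(3)[rule_format, of v] sum[of v] by linarith
      then show False using k(2) kk by blast
    qed
    show ?thesis by (rule subset_three_interval[OF sub mid])
  qed
  ultimately have "improper_interval_coloring 2 V E \<alpha>"
    unfolding improper_interval_coloring_def improper_coloring_def interval_coloring_def by blast
  then show ?thesis unfolding mu_int_def by (intro Least_le) blast
qed

end
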